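(* Let $\mu$ be a Gaussian measure on a separable reproducing kernel Hilbert space $\mathcal{H}$ of functions over a compact metric space $D$. Let $\Omega=\mathcal{H}$ and let $\mathcal{F}$ be the Borel $\sigma$-algebra on $\mathcal{H}$. Then the collection of random variables $$Z_s:(\Omega,\mathcal{F},\mu)\to(\mathbb{R},\mathcal{B}(\mathbb{R})),\qquad \omega\mapsto\delta_s(\omega)=\omega(s),\qquad s\in D,$$ is a Gaussian process with paths in $\mathcal{H}$ which induces $\mu$ on $\mathcal{H}$.
   Context: A Gaussian measure on a separable Banach space $X$ is a Borel probability measure $\mu$ on $X$ such that for every $\ell\in X^*$ the pushforward $\mu\circ\ell^{-1}$ is Gaussian (possibly degenerate) on $\mathbb{R}$. A Gaussian process on $D$ is a real-valued stochastic process $(Z_s)_{s\in D}$ such that for any finitely many $s_1,\dots,s_n\in D$ the vector $(Z_{s_1},\dots,Z_{s_n})$ is Gaussian. A reproducing kernel Hilbert space over $D$ is a Hilbert space of real-valued functions on $D$ for which all evaluation functionals $\delta_s$ are continuous. A process $Z$ on $(\Omega,\mathcal{F},\mathbb{P})$ with paths in $\mathcal{H}$ induces on $\mathcal{H}$ the measure $\mathbb{P}\circ\Phi^{-1}$, where $\Phi(\omega)=Z(\cdot\,;\omega)\in\mathcal{H}$. *)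

theory Defs
  imports "HOL-Analysis.Analysis" "HOL-Probability.Probability"
begin

section \<open>Reproducing kernel Hilbert spaces\<close>

text \<open>
  Real-valued functions on a set \<open>D\<close> are elements of \<open>extensional D\<close>, so that two of them are
  equal exactly if they agree on \<open>D\<close>.
\<close>

definition fun_zero :: "'d set \<Rightarrow> 'd \<Rightarrow> real"
  where "fun_zero D = (\<lambda>s\<in>D. 0)"

definition fun_add :: "'d set \<Rightarrow> ('d \<Rightarrow> real) \<Rightarrow> ('d \<Rightarrow> real) \<Rightarrow> 'd \<Rightarrow> real"
  where "fun_add D f g = (\<lambda>s\<in>D. f s + g s)"

definition fun_scale :: "'d set \<Rightarrow> real \<Rightarrow> ('d \<Rightarrow> real) \<Rightarrow> 'd \<Rightarrow> real"
  where "fun_scale D c f = (\<lambda>s\<in>D. c * f s)"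

definition fun_diff :: "'d set \<Rightarrow> ('d \<Rightarrow> real) \<Rightarrow> ('d \<Rightarrow> real) \<Rightarrow> 'd \<Rightarrow> real"
  where "fun_diff D f g = (\<lambda>s\<in>D. f s - g s)"

text \<open>
  The value \<open>0\<close> outside of \<open>H\<close> is immaterial; it is there because \<open>Metric_space\<close> requires
  nonnegativity and symmetry of the distance on the whole type.
\<close>

definition hdist :: "'d set \<Rightarrow> ('d \<Rightarrow> real) set \<Rightarrow> (('d \<Rightarrow> real) \<Rightarrow> ('d \<Rightarrow> real) \<Rightarrow> real)
    \<Rightarrow> ('d \<Rightarrow> real) \<Rightarrow> ('d \<Rightarrow> real) \<Rightarrow> real"
  where "hdist D H ip f g =
    (if f \<in> H \<and> g \<in> H then sqrt (ip (fun_diff D f g) (fun_diff D f g)) else 0)"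

abbreviation htopology :: "'d set \<Rightarrow> ('d \<Rightarrow> real) set \<Rightarrow> (('d \<Rightarrow> real) \<Rightarrow> ('d \<Rightarrow> real) \<Rightarrow> real)
    \<Rightarrow> ('d \<Rightarrow> real) topology"
  where "htopology D H ip \<equiv> Metric_space.mtopology H (hdist D H ip)"

locale function_inner_space =
  fixes D :: "'d set"
    and H :: "('d \<Rightarrow> real) set"
    and ip :: "('d \<Rightarrow> real) \<Rightarrow> ('d \<Rightarrow> real) \<Rightarrow> real"
  assumes subset_extensional: "H \<subseteq> extensional D"
    and zero_mem: "fun_zero D \<in> H"
    and add_mem: "\<And>f g. f \<in> H \<Longrightarrow> g \<in> H \<Longrightarrow> fun_add D f g \<in> H"
    and scale_mem: "\<And>c f. f \<in> H \<Longrightarrow> fun_scale D c f \<in> H"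
    and ip_commute: "\<And>f g. f \<in> H \<Longrightarrow> g \<in> H \<Longrightarrow> ip f g = ip g f"
    and ip_add: "\<And>f g h. f \<in> H \<Longrightarrow> g \<in> H \<Longrightarrow> h \<in> H \<Longrightarrow>
      ip (fun_add D f g) h = ip f h + ip g h"
    and ip_scale: "\<And>c f g. f \<in> H \<Longrightarrow> g \<in> H \<Longrightarrow> ip (fun_scale D c f) g = c * ip f g"
    and ip_pos: "\<And>f. f \<in> H \<Longrightarrow> f \<noteq> fun_zero D \<Longrightarrow> 0 < ip f f"
begin

lemma ip_zero_left: "g \<in> H \<Longrightarrow> ip (fun_zero D) g = 0"
proof -
  assume g: "g \<in> H"
  have "fun_scale D 0 (fun_zero D) = fun_zero D"
    by (auto simp: fun_scale_def fun_zero_def)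
  then show ?thesis
    using ip_scale[OF zero_mem g, of 0] by simp
qed

lemma ip_nonneg: "f \<in> H \<Longrightarrow> 0 \<le> ip f f"
  using ip_pos[of f] ip_zero_left[of f] by fastforce

lemma diff_conv: "fun_diff D f g = fun_add D f (fun_scale D (-1) g)"
  by (auto simp: fun_diff_def fun_add_def fun_scale_def)

lemma diff_mem: "f \<in> H \<Longrightarrow> g \<in> H \<Longrightarrow> fun_diff D f g \<in> H"
  by (simp add: diff_conv add_mem scale_mem)

lemma ip_combination:
  assumes "f \<in> H" "g \<in> H"
  shows "ip (fun_add D f (fun_scale D c g)) (fun_add D f (fun_scale D c g)) =
    ip f f + 2 * c * ip f g + c\<^sup>2 * ip g g"
proof -
  let ?h = "fun_add D f (fun_scale D c g)"
  have m: "?h \<in> H" "fun_scale D c g \<in> H"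
    using assms by (auto simp: add_mem scale_mem)
  have l: "ip ?h k = ip f k + c * ip g k" if "k \<in> H" for k
    using that assms m by (simp add: ip_add ip_scale)
  have "ip ?h ?h = ip ?h f + c * ip ?h g"
    using l[OF m(1)] ip_commute assms m by simp
  also have "\<dots> = ip f f + c * ip g f + c * (ip f g + c * ip g g)"
    using l assms by simp
  finally show ?thesis
    using ip_commute[OF assms] by (simp add: algebra_simps power2_eq_square)
qed

lemma Cauchy_Schwarz:
  assumes "f \<in> H" "g \<in> H"
  shows "(ip f g)\<^sup>2 \<le> ip f f * ip g g"
proof (cases "g = fun_zero D")
  case True
  then show ?thesis
    using assms ip_commute[OF assms] ip_zero_left by (simp add: zero_mem)
next
  case False
  then have pos: "0 < ip g g"
    using assms ip_pos by blast
  define c where "c = - ip f g / ip g g"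
  have "0 \<le> ip f f + 2 * c * ip f g + c\<^sup>2 * ip g g"
    using ip_combination[OF assms, of c] ip_nonneg[of "fun_add D f (fun_scale D c g)"] assms
    by (simp add: add_mem scale_mem)
  also have "\<dots> = ip f f - (ip f g)\<^sup>2 / ip g g"
    using pos by (simp add: c_def power2_eq_square)
  finally show ?thesis
    using pos by (simp add: field_simps)
qed

lemma norm_triangle:
  assumes "f \<in> H" "g \<in> H"
  shows "sqrt (ip (fun_add D f g) (fun_add D f g)) \<le> sqrt (ip f f) + sqrt (ip g g)"
proof -
  have "fun_scale D 1 g = g"
    using assms subset_extensional by (auto simp: fun_scale_def extensional_def fun_eq_iff)
  then have e: "ip (fun_add D f g) (fun_add D f g) = ip f f + 2 * ip f g + ip g g"
    using ip_combination[OF assms, of 1] by simp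
  have "ip f g \<le> sqrt (ip f f) * sqrt (ip g g)"
    using Cauchy_Schwarz[OF assms] real_le_rsqrt by (simp flip: real_sqrt_mult)
  then have "ip (fun_add D f g) (fun_add D f g) \<le> (sqrt (ip f f) + sqrt (ip g g))\<^sup>2"
    using e assms ip_nonneg by (simp add: power2_sum)
  then show ?thesis
    using assms ip_nonneg by (simp add: real_le_lsqrt add_mem)
qed

sublocale Metric_space H "hdist D H ip"
proof
  fix x y z
  show "0 \<le> hdist D H ip x y"
    by (simp add: hdist_def ip_nonneg diff_mem)
  show "hdist D H ip x y = hdist D H ip y x"
  proof (cases "x \<in> H \<and> y \<in> H")
    case True
    have s: "fun_diff D y x = fun_scale D (-1) (fun_diff D x y)"
      by (auto simp: fun_diff_def fun_scale_def)
    have m: "fun_diff D x y \<in> H" "fun_scale D (-1) (fun_diff D x y) \<in> H"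
      using True by (auto simp: diff_mem scale_mem)
    have "ip (fun_diff D y x) (fun_diff D y x) = ip (fun_diff D x y) (fun_diff D x y)"
      unfolding s using m ip_commute[OF m] by (simp add: ip_scale)
    then show ?thesis
      by (simp add: hdist_def)
  qed (auto simp: hdist_def)
  assume xy: "x \<in> H" "y \<in> H"
  have "x = y" if "fun_diff D x y = fun_zero D"
  proof (rule extensionalityI)
    show "x \<in> extensional D" "y \<in> extensional D"
      using xy subset_extensional by auto
    show "x s = y s" if "s \<in> D" for s
      using fun_cong[OF \<open>fun_diff D x y = fun_zero D\<close>, of s] that
      by (simp add: fun_diff_def fun_zero_def)
  qed
  moreover have "fun_diff D x x = fun_zero D"
    by (auto simp: fun_diff_def fun_zero_def)
  ultimately show "hdist D H ip x y = 0 \<longleftrightarrow> x = y"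
    using xy ip_pos[OF diff_mem[OF xy]] ip_zero_left[OF zero_mem]
    by (cases "fun_diff D x y = fun_zero D") (auto simp: hdist_def)
  assume z: "z \<in> H"
  have "fun_diff D x z = fun_add D (fun_diff D x y) (fun_diff D y z)"
    by (auto simp: fun_diff_def fun_add_def)
  then show "hdist D H ip x z \<le> hdist D H ip x y + hdist D H ip y z"
    using norm_triangle[of "fun_diff D x y" "fun_diff D y z"] xy z
    by (simp add: hdist_def diff_mem)
qed

end

locale rkhs = function_inner_space +
  assumes complete: mcomplete
    and continuous_evaluation: "\<And>s. s \<in> D \<Longrightarrow> continuous_map mtopology euclideanreal (\<lambda>f. f s)"

definition hborel :: "'d set \<Rightarrow> ('d \<Rightarrow> real) set \<Rightarrow> (('d \<Rightarrow> real) \<Rightarrow> ('d \<Rightarrow> real) \<Rightarrow> real)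
    \<Rightarrow> ('d \<Rightarrow> real) measure"
  where "hborel D H ip = sigma H {U. openin (htopology D H ip) U}"

definition hdual :: "'d set \<Rightarrow> ('d \<Rightarrow> real) set \<Rightarrow> (('d \<Rightarrow> real) \<Rightarrow> ('d \<Rightarrow> real) \<Rightarrow> real)
    \<Rightarrow> (('d \<Rightarrow> real) \<Rightarrow> real) set"
  where "hdual D H ip = {l.
    (\<forall>f\<in>H. \<forall>g\<in>H. l (fun_add D f g) = l f + l g) \<and>
    (\<forall>c. \<forall>f\<in>H. l (fun_scale D c f) = c * l f) \<and>
    continuous_map (htopology D H ip) euclideanreal l}"

section \<open>Gaussian measures and Gaussian processes\<close>

text \<open>Dirac measures are the degenerate Gaussian measures.\<close>

definition gaussian_real :: "real measure \<Rightarrow> bool"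
  where "gaussian_real \<nu> \<longleftrightarrow>
    (\<exists>m. \<nu> = return borel m) \<or>
    (\<exists>m \<sigma>. 0 < \<sigma> \<and> \<nu> = density lborel (normal_density m \<sigma>))"

text \<open>
  In \<open>gaussian_on B L \<mu>\<close>, the measurable space \<open>B\<close> is the underlying space with its Borel
  sigma-algebra, and \<open>L\<close> is its set of continuous linear functionals.
\<close>

definition gaussian_on :: "'a measure \<Rightarrow> ('a \<Rightarrow> real) set \<Rightarrow> 'a measure \<Rightarrow> bool"
  where "gaussian_on B L \<mu> \<longleftrightarrow>
    prob_space \<mu> \<and> sets \<mu> = sets B \<and> (\<forall>l\<in>L. gaussian_real (distr \<mu> borel l))"

definition gaussian_measure :: "'d set \<Rightarrow> ('d \<Rightarrow> real) set
    \<Rightarrow> (('d \<Rightarrow> real) \<Rightarrow> ('d \<Rightarrow> real) \<Rightarrow> real) \<Rightarrow> ('d \<Rightarrow> real) measure \<Rightarrow> bool"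
  where "gaussian_measure D H ip \<mu> \<longleftrightarrow> gaussian_on (hborel D H ip) (hdual D H ip) \<mu>"

text \<open>
  A random vector \<open>(X 0, \<dots>, X (n - 1))\<close> is Gaussian if its joint law is a Gaussian measure
  on \<open>n\<close>-dimensional Euclidean space, here represented as \<open>Pi\<^sub>M {..<n} (\<lambda>_. borel)\<close>.
\<close>

definition gaussian_vector :: "'w measure \<Rightarrow> nat \<Rightarrow> (nat \<Rightarrow> 'w \<Rightarrow> real) \<Rightarrow> bool"
  where "gaussian_vector M n X \<longleftrightarrow>
    (\<forall>i<n. X i \<in> borel_measurable M) \<and>
    gaussian_on (Pi\<^sub>M {..<n} (\<lambda>_. borel)) (range (\<lambda>a x. \<Sum>i<n. a i * x i))
      (distr M (Pi\<^sub>M {..<n} (\<lambda>_. borel)) (\<lambda>\<omega>. \<lambda>i\<in>{..<n}. X i \<omega>))"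

definition gaussian_process :: "'w measure \<Rightarrow> 'd set \<Rightarrow> ('d \<Rightarrow> 'w \<Rightarrow> real) \<Rightarrow> bool"
  where "gaussian_process M D Z \<longleftrightarrow>
    prob_space M \<and> (\<forall>s\<in>D. Z s \<in> borel_measurable M) \<and>
    (\<forall>n. \<forall>s :: nat \<Rightarrow> 'd. (\<forall>i<n. s i \<in> D) \<longrightarrow> gaussian_vector M n (\<lambda>i. Z (s i)))"

definition sample_path :: "'d set \<Rightarrow> ('d \<Rightarrow> 'w \<Rightarrow> real) \<Rightarrow> 'w \<Rightarrow> 'd \<Rightarrow> real"
  where "sample_path D Z \<omega> = (\<lambda>s\<in>D. Z s \<omega>)"

definition paths_in :: "'w measure \<Rightarrow> 'd set \<Rightarrow> ('d \<Rightarrow> 'w \<Rightarrow> real) \<Rightarrow> ('d \<Rightarrow> real) set \<Rightarrow> bool"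
  where "paths_in M D Z H \<longleftrightarrow> (\<forall>\<omega>\<in>space M. sample_path D Z \<omega> \<in> H)"

text \<open>
  Measurability of the path map is part of the definition since \<open>distr\<close> is meaningless for
  non-measurable maps.
\<close>

definition induces :: "'w measure \<Rightarrow> 'd set \<Rightarrow> ('d \<Rightarrow> 'w \<Rightarrow> real) \<Rightarrow> ('d \<Rightarrow> real) measure
    \<Rightarrow> ('d \<Rightarrow> real) measure \<Rightarrow> bool"
  where "induces M D Z B \<mu> \<longleftrightarrow> sample_path D Z \<in> measurable M B \<and> distr M B (sample_path D Z) = \<mu>"

end

theory Submission
  imports Defs
begin

text \<open>
  Since point evaluations are continuous and linear on \<open>H\<close>, every linear combination
  \<open>\<omega> \<mapsto> \<Sum>i<n. a i * \<omega> (s i)\<close> belongs to the dual of \<open>H\<close> (\<open>evaluation_combination_in_hdual\<close>).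
  The law of this functional under \<open>\<mu>\<close> is the law of the same linear combination of the
  coordinates of the random vector \<open>(Z (s 0), \<dots>, Z (s (n - 1)))\<close>. Gaussianity of \<open>\<mu>\<close>, tested on
  these functionals only, is therefore Gaussianity of all finite-dimensional laws of the
  evaluation process (\<open>gaussian_vectorI\<close>). The path of this process at \<open>\<omega> \<in> H\<close> is \<open>\<omega>\<close> itself, so
  the path map is the identity of \<open>H\<close> and pushes \<open>\<mu>\<close> forward to \<open>\<mu>\<close>.
\<close>

lemma continuous_map_measurable_sigma_openin:
  assumes f: "continuous_map T euclidean f"
  shows "f \<in> borel_measurable (sigma (topspace T) {U. openin T U})"
proof (rule borel_measurableI)
  fix S :: "'b set" assume "open S"
  then have "openin T {x \<in> topspace T. f x \<in> S}"
    using f by (simp add: openin_continuous_map_preimage)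
  moreover have "{U. openin T U} \<subseteq> Pow (topspace T)"
    by (auto dest: openin_subset)
  moreover have "f -` S \<inter> topspace T = {x \<in> topspace T. f x \<in> S}"
    by blast
  ultimately show "f -` S \<inter> space (sigma (topspace T) {U. openin T U})
      \<in> sets (sigma (topspace T) {U. openin T U})"
    by simp
qed

context function_inner_space
begin

lemma space_hborel: "space (hborel D H ip) = H"
  by (simp add: hborel_def space_measure_of_conv)

lemma continuous_map_measurable_hborel:
  fixes f :: "('d \<Rightarrow> real) \<Rightarrow> real"
  assumes "continuous_map mtopology euclideanreal f"
  shows "f \<in> borel_measurable (hborel D H ip)"
  using continuous_map_measurable_sigma_openin[OF assms] by (simp add: hborel_def)

lemma sample_path_evaluation: "\<omega> \<in> H \<Longrightarrow> sample_path D (\<lambda>s \<omega>. \<omega> s) \<omega> = \<omega>"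
  using subset_extensional by (auto simp: sample_path_def extensional_restrict)

end

context rkhs
begin

lemma evaluation_combination_in_hdual:
  assumes s: "\<And>i. i \<in> I \<Longrightarrow> s i \<in> D" and I: "finite I"
  shows "(\<lambda>f. \<Sum>i\<in>I. a i * f (s i)) \<in> hdual D H ip"
  unfolding hdual_def
proof (intro CollectI conjI ballI allI)
  fix f g
  show "(\<Sum>i\<in>I. a i * fun_add D f g (s i)) = (\<Sum>i\<in>I. a i * f (s i)) + (\<Sum>i\<in>I. a i * g (s i))"
    using s by (simp add: fun_add_def distrib_left sum.distrib)
next
  fix c f
  show "(\<Sum>i\<in>I. a i * fun_scale D c f (s i)) = c * (\<Sum>i\<in>I. a i * f (s i))"
    using s by (simp add: fun_scale_def sum_distrib_left mult.left_commute)
next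
  show "continuous_map mtopology euclideanreal (\<lambda>f. \<Sum>i\<in>I. a i * f (s i))"
    using s I continuous_evaluation
    by (intro continuous_map_sum continuous_map_real_mult_left) auto
qed

end

text \<open>
  The law of a linear functional under the joint law of a random vector is the law of the
  corresponding combination of its coordinates.
\<close>

lemma gaussian_vectorI:
  assumes M: "prob_space M"
    and X: "\<And>i. i < n \<Longrightarrow> X i \<in> borel_measurable M"
    and gauss: "\<And>a. gaussian_real (distr M borel (\<lambda>\<omega>. \<Sum>i<n. a i * X i \<omega>))"
  shows "gaussian_vector M n X"
proof -
  let ?B = "Pi\<^sub>M {..<n} (\<lambda>_. borel :: real measure)"
  have joint: "(\<lambda>\<omega>. \<lambda>i\<in>{..<n}. X i \<omega>) \<in> measurable M ?B"
    using X by (intro measurable_restrict) auto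
  have "gaussian_real (distr (distr M ?B (\<lambda>\<omega>. \<lambda>i\<in>{..<n}. X i \<omega>)) borel (\<lambda>x. \<Sum>i<n. a i * x i))" for a
  proof -
    have "(\<lambda>x. \<Sum>i<n. a i * x i) \<in> borel_measurable ?B"
      by (intro borel_measurable_sum borel_measurable_times borel_measurable_const
          measurable_component_singleton)
    then show ?thesis
      using gauss[of a] by (simp add: distr_distr joint comp_def)
  qed
  then show ?thesis
    using X joint by (auto simp: gaussian_vector_def gaussian_on_def
        intro!: prob_space.prob_space_distr[OF M])
qed

theorem theorem4:
  fixes D :: "'d::metric_space set"
    and H :: "('d \<Rightarrow> real) set"
    and ip :: "('d \<Rightarrow> real) \<Rightarrow> ('d \<Rightarrow> real) \<Rightarrow> real"
    and \<mu> :: "('d \<Rightarrow> real) measure"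
    and Z :: "'d \<Rightarrow> ('d \<Rightarrow> real) \<Rightarrow> real"
  assumes "compact D"
    and "rkhs D H ip"
    and "separable_space (htopology D H ip)"
    and "gaussian_measure D H ip \<mu>"
    and Z_def: "Z = (\<lambda>s \<omega>. \<omega> s)"
  shows "gaussian_process \<mu> D Z \<and> paths_in \<mu> D Z H \<and> induces \<mu> D Z (hborel D H ip) \<mu>"
proof -
  interpret rkhs D H ip by fact
  have prob: "prob_space \<mu>" and sets: "sets \<mu> = sets (hborel D H ip)"
    and gauss: "\<And>l. l \<in> hdual D H ip \<Longrightarrow> gaussian_real (distr \<mu> borel l)"
    using assms(4) by (auto simp: gaussian_measure_def gaussian_on_def)
  have space: "space \<mu> = H"
    using sets_eq_imp_space_eq[OF sets] by (simp add: space_hborel)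
  have Z_measurable: "Z s \<in> borel_measurable \<mu>" if "s \<in> D" for s
    using continuous_map_measurable_hborel[OF continuous_evaluation[OF that]]
    by (simp add: Z_def measurable_cong_sets[OF sets refl])
  have "gaussian_vector \<mu> n (\<lambda>i. Z (s i))" if "\<forall>i<n. s i \<in> D" for n and s :: "nat \<Rightarrow> 'd"
  proof (rule gaussian_vectorI[OF prob])
    show "gaussian_real (distr \<mu> borel (\<lambda>\<omega>. \<Sum>i<n. a i * Z (s i) \<omega>))" for a
      unfolding Z_def using that by (intro gauss evaluation_combination_in_hdual) auto
  qed (use that Z_measurable in auto)
  then have process: "gaussian_process \<mu> D Z"
    using prob Z_measurable by (simp add: gaussian_process_def)
  have path: "sample_path D Z \<omega> = \<omega>" if "\<omega> \<in> H" for \<omega>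
    using sample_path_evaluation[OF that] by (simp add: Z_def)
  then have paths: "paths_in \<mu> D Z H"
    by (simp add: paths_in_def space)
  have "sample_path D Z \<in> measurable \<mu> (hborel D H ip)"
    using measurable_cong[of \<mu> "sample_path D Z" "\<lambda>\<omega>. \<omega>" "hborel D H ip"] path
    by (simp add: space measurable_ident_sets[OF sets])
  moreover have "distr \<mu> (hborel D H ip) (sample_path D Z) = distr \<mu> \<mu> (\<lambda>\<omega>. \<omega>)"
    by (rule distr_cong) (simp_all add: sets space path)
  ultimately have "induces \<mu> D Z (hborel D H ip) \<mu>"
    by (simp add: induces_def distr_id)
  with process paths show ?thesis by blast
qed

end
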